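(* Let $G\cong \mathrm{PSU}(3,q)$, where $q\ge 4$ is even (i.e. $q$ is a power of $2$). Then $\Gamma_S(G)$ is not a cograph.
   Context: For a group $G$ with identity $e$, the intersection subgroup graph $\Gamma_S(G)$ is the simple graph whose vertices are the non-trivial subgroups $H$ of $G$ such that $H\cap K=\{e\}$ for some non-trivial subgroup $K$ of $G$; two distinct vertices $H,K$ are adjacent if and only if $H\cap K=\{e\}$. A graph is a cograph if it has no induced subgraph isomorphic to the path $P_4$ on four vertices. $\mathrm{PSU}(3,q)$ is the projective special unitary group of dimension $3$ defined over the field with $q^2$ elements. *)

theory Defs
  imports
    "HOL-Analysis.Determinants"
    "HOL-Library.Numeral_Type"
    "HOL-Algebra.Coset"
    "Graph_Theory.Pair_Digraph"
    "Graph_Theory.Digraph_Component"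
    "Graph_Theory.Digraph_Isomorphism"
begin

section \<open>The projective special unitary group\<close>

text \<open>
  Let \<open>F\<close> be the field with \<open>q\<^sup>2\<close> elements. The map \<open>x \<mapsto> x\<^sup>q\<close> is then the involutory
  automorphism of \<open>F\<close>. Since all nondegenerate Hermitian forms on a vector space of given finite
  dimension over \<open>F\<close> are equivalent up to a change of basis, we use the form
  \<open>(x, y) \<mapsto> \<Sum>i. x i * (y i)\<^sup>q\<close>, whose Gram matrix is the identity. The definitions in this
  section have their intended meaning only if the type of scalars is a field with
  \<open>q\<^sup>2\<close> elements; this is an explicit assumption wherever they are used.
\<close>

definition conj_transpose :: "nat \<Rightarrow> 'a::field ^ 'n ^ 'm \<Rightarrow> 'a ^ 'm ^ 'n" where
  "conj_transpose q A = (\<chi> i j. (A $ j $ i) ^ q)"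

definition SU :: "nat \<Rightarrow> ('a::field ^ 'n ^ 'n) monoid" where
  "SU q = \<lparr>carrier = {A. A ** conj_transpose q A = mat 1 \<and> det A = 1},
           monoid.mult = (**), one = mat 1\<rparr>"

definition SU_scalars :: "nat \<Rightarrow> ('a::field ^ 'n ^ 'n) set" where
  "SU_scalars q = {A \<in> carrier (SU q). \<exists>c. A = mat c}"

definition PSU :: "nat \<Rightarrow> ('a::field ^ 'n ^ 'n) set monoid" where
  "PSU q = SU q Mod SU_scalars q"

section \<open>Cographs\<close>

text \<open>
  Simple graphs are represented as loopfree symmetric digraphs without parallel arcs:
  an edge between \<open>u\<close> and \<open>v\<close> is the pair of arcs \<open>(u, v)\<close> and \<open>(v, u)\<close>.
\<close>

definition path_graph :: "nat \<Rightarrow> nat pair_pre_digraph" where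
  "path_graph n = \<lparr>pverts = {..<n},
                   parcs = {(i, j). i < n \<and> j < n \<and> (j = Suc i \<or> i = Suc j)}\<rparr>"

definition cograph :: "'v pair_pre_digraph \<Rightarrow> bool" where
  "cograph \<Gamma> \<longleftrightarrow>
     \<not> (\<exists>H. induced_subgraph H (with_proj \<Gamma>) \<and> digraph_iso H (with_proj (path_graph 4)))"

section \<open>The intersection subgroup graph\<close>

definition nontrivial_subgroup :: "('g, 'b) monoid_scheme \<Rightarrow> 'g set \<Rightarrow> bool" where
  "nontrivial_subgroup G H \<longleftrightarrow> subgroup H G \<and> H \<noteq> {\<one>\<^bsub>G\<^esub>}"

definition isg_verts :: "('g, 'b) monoid_scheme \<Rightarrow> 'g set set" where
  "isg_verts G = {H. nontrivial_subgroup G H \<and>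
                     (\<exists>K. nontrivial_subgroup G K \<and> H \<inter> K = {\<one>\<^bsub>G\<^esub>})}"

definition intersection_subgroup_graph ::
    "('g, 'b) monoid_scheme \<Rightarrow> 'g set pair_pre_digraph" where
  "intersection_subgroup_graph G =
     \<lparr>pverts = isg_verts G,
      parcs = {(H, K). H \<in> isg_verts G \<and> K \<in> isg_verts G \<and> H \<noteq> K \<and> H \<inter> K = {\<one>\<^bsub>G\<^esub>}}\<rparr>"

lemma pair_bidirected_digraph_path_graph: "pair_bidirected_digraph (path_graph n)"
  by unfold_locales (simp_all add: path_graph_def symmetric_def sym_def split: prod.splits, auto)

lemma pair_bidirected_digraph_intersection_subgroup_graph:
  "pair_bidirected_digraph (intersection_subgroup_graph G)"
  by unfold_locales
    (simp_all add: intersection_subgroup_graph_def symmetric_def sym_def Int_commute split: prod.splits, auto)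

end

theory Submission
  imports Defs "HOL-Computational_Algebra.Polynomial" "HOL-Number_Theory.Residues"
begin

text \<open>
  Suppose that \<open>x \<noteq> z\<close> are involutions of \<open>G\<close> commuting with a nontrivial element \<open>y\<close> of odd order.
  Then \<open>x\<close> is the only involution of \<open>\<langle>x, y\<rangle>\<close> and \<open>z\<close> the only one of \<open>\<langle>z, y\<rangle>\<close>, so the vertices
  \<open>\<langle>x, y\<rangle>\<close>, \<open>\<langle>z\<rangle>\<close>, \<open>\<langle>x\<rangle>\<close>, \<open>\<langle>z, y\<rangle>\<close>, in this order, induce a path on four vertices.

  In \<open>PSU(3, q)\<close> such elements are given by monomial matrices. As \<open>q + 1 > 3\<close>, there is a scalar
  \<open>a\<close> with \<open>a\<^sup>q\<^sup>+\<^sup>1 = 1\<close> and \<open>a\<^sup>3 \<noteq> 1\<close>. Take for \<open>y\<close> the class of the diagonal matrix with entries \<open>a, a, a\<^sup>-\<^sup>2\<close>,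
  whose order divides the odd number \<open>q + 1\<close>, and for \<open>x\<close> and \<open>z\<close> the classes of the matrices that
  swap the first two coordinates with weights \<open>b, b\<^sup>-\<^sup>1\<close>, where \<open>b = 1\<close> and \<open>b = a\<close>. These have
  determinant \<open>-1 = 1\<close> because the characteristic is \<open>2\<close>.
\<close>

section \<open>Induced four-vertex paths in the intersection subgroup graph\<close>

lemma not_cographI:
  fixes f :: "nat \<Rightarrow> 'v"
  assumes wf: "pair_wf_digraph \<Gamma>"
    and inj: "inj_on f {..<4}"
    and verts: "f ` {..<4} \<subseteq> pverts \<Gamma>"
    and arcs: "\<And>i j. i < 4 \<Longrightarrow> j < 4 \<Longrightarrow> (f i, f j) \<in> parcs \<Gamma> \<longleftrightarrow> (i, j) \<in> parcs (path_graph 4)"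
  shows "\<not> cograph \<Gamma>"
proof -
  define V where "V = f ` {..<4}"
  define H where "H = \<lparr>pverts = V, parcs = parcs \<Gamma> \<inter> V \<times> V\<rparr>"
  define g where "g = the_inv_into {..<4} f"
  have gf: "g (f i) = i" if "i < 4" for i
    unfolding g_def using that by (intro the_inv_into_f_f[OF inj]) auto
  have inj_g: "inj_on g V"
    unfolding g_def V_def by (rule inj_on_the_inv_into[OF inj])
  have wfH: "wf_digraph (with_proj H)"
    unfolding wf_digraph_wp_iff by unfold_locales (auto simp: H_def)
  have ind: "induced_subgraph (with_proj H) (with_proj \<Gamma>)"
    using wf wfH verts
    by (auto simp: induced_subgraph_def subgraph_def compatible_def wf_digraph_wp_iff H_def V_def)
  \<comment> \<open>Arcs are pairs of vertices here, so \<open>g\<close> determines the arc map, and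
    head and tail of a renamed arc are again its projections.\<close>
  define h where "h = \<lparr>iso_verts = g, iso_arcs = map_prod g g, iso_head = snd, iso_tail = fst\<rparr>"
  have inj_arcs: "inj_on (map_prod g g) (parcs \<Gamma> \<inter> V \<times> V)"
    using map_prod_inj_on[OF inj_g inj_g] by (rule inj_on_subset) auto
  have "pre_digraph.digraph_isomorphism (with_proj H) h"
    using inj_g wfH inj_arcs
    by (auto simp: pre_digraph.digraph_isomorphism_def h_def H_def)
  moreover have "with_proj (path_graph 4) = app_iso h (with_proj H)"
  proof -
    have "g ` V = {..<4}"
      unfolding V_def image_image by (auto simp: gf intro!: image_eqI)
    moreover have "map_prod g g ` (parcs \<Gamma> \<inter> V \<times> V) = parcs (path_graph 4)"
    proof (intro equalityI subrelI)
      fix i j assume "(i, j) \<in> map_prod g g ` (parcs \<Gamma> \<inter> V \<times> V)"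
      then show "(i, j) \<in> parcs (path_graph 4)"
        by (auto simp: V_def gf arcs)
    next
      fix i j assume ij: "(i, j) \<in> parcs (path_graph 4)"
      then have "i < 4" "j < 4" by (auto simp: path_graph_def)
      with ij show "(i, j) \<in> map_prod g g ` (parcs \<Gamma> \<inter> V \<times> V)"
        by (intro image_eqI[of _ _ "(f i, f j)"]) (auto simp: V_def gf arcs)
    qed
    ultimately show ?thesis
      by (simp add: app_iso_def h_def H_def with_proj_def path_graph_def)
  qed
  ultimately have "digraph_iso (with_proj H) (with_proj (path_graph 4))"
    unfolding digraph_iso_def by blast
  with ind show ?thesis unfolding cograph_def by blast
qed

lemma isg_vertsI:
  "nontrivial_subgroup G H \<Longrightarrow> nontrivial_subgroup G K \<Longrightarrow> H \<inter> K = {\<one>\<^bsub>G\<^esub>} \<Longrightarrow> H \<in> isg_verts G"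
  by (auto simp: isg_verts_def)

lemma not_cograph_intersection_subgroup_graphI:
  assumes nontriv: "nontrivial_subgroup G A" "nontrivial_subgroup G B"
      "nontrivial_subgroup G C" "nontrivial_subgroup G D"
    and disj: "A \<inter> B = {\<one>\<^bsub>G\<^esub>}" "B \<inter> C = {\<one>\<^bsub>G\<^esub>}" "C \<inter> D = {\<one>\<^bsub>G\<^esub>}"
    and meet: "A \<inter> C \<noteq> {\<one>\<^bsub>G\<^esub>}" "A \<inter> D \<noteq> {\<one>\<^bsub>G\<^esub>}" "B \<inter> D \<noteq> {\<one>\<^bsub>G\<^esub>}"
  shows "\<not> cograph (intersection_subgroup_graph G)"
proof -
  define f where "f = (\<lambda>i::nat. [A, B, C, D] ! i)"
  have f: "f 0 = A" "f (Suc 0) = B" "f (Suc (Suc 0)) = C" "f (Suc (Suc (Suc 0))) = D"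
    by (simp_all add: f_def)
  have four: "{..<4} = {0, Suc 0, Suc (Suc 0), Suc (Suc (Suc 0))}" by auto
  have lt4: "i < 4 \<longleftrightarrow> i = 0 \<or> i = Suc 0 \<or> i = Suc (Suc 0) \<or> i = Suc (Suc (Suc 0))" for i :: nat
    by auto
  \<comment> \<open>Subgroups adjacent on the path are nontrivial and meet trivially. For any other
    pair, some third subgroup or one of the two meets exactly one of them trivially.\<close>
  have ne: "A \<noteq> B" "A \<noteq> C" "A \<noteq> D" "B \<noteq> C" "B \<noteq> D" "C \<noteq> D"
    using nontriv disj meet unfolding nontrivial_subgroup_def by (metis Int_absorb Int_commute)+
  have "A \<in> isg_verts G" "B \<in> isg_verts G" "C \<in> isg_verts G" "D \<in> isg_verts G"
    using isg_vertsI[of G A B] isg_vertsI[of G B A] isg_vertsI[of G C D] isg_vertsI[of G D C] nontriv disj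
    by (simp_all add: Int_commute)
  then have verts: "{A, B, C, D} \<subseteq> isg_verts G"
    by simp
  have "pair_wf_digraph (intersection_subgroup_graph G)"
    using pair_bidirected_digraph_intersection_subgroup_graph[of G]
    by (simp add: pair_bidirected_digraph_def pair_sym_digraph_def)
  then show ?thesis
  proof (rule not_cographI)
    show "inj_on f {..<4}"
      using ne by (auto simp: four f)
    show "f ` {..<4} \<subseteq> pverts (intersection_subgroup_graph G)"
      using verts by (simp add: four f intersection_subgroup_graph_def)
    fix i j :: nat assume "i < 4" "j < 4"
    then show "(f i, f j) \<in> parcs (intersection_subgroup_graph G) \<longleftrightarrow> (i, j) \<in> parcs (path_graph 4)"
      using verts ne disj meet unfolding lt4
      by (elim disjE; simp add: f intersection_subgroup_graph_def path_graph_def Int_commute)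
  qed
qed

section \<open>Involutions commuting with an element of odd order\<close>

lemma (in group) involution_nat_pow:
  assumes "u \<in> carrier G" "u \<otimes> u = \<one>"
  shows "u [^] (i::nat) = (if even i then \<one> else u)"
  using assms by (induction i) auto

text \<open>Finite orders allow natural exponents throughout: \<open>u [^] ((m - 1) * i)\<close> is
  the inverse of \<open>u [^] i\<close>, and likewise for \<open>v\<close>.\<close>

lemma (in group) subgroup_commuting_powers:
  assumes u: "u \<in> carrier G" "u [^] (m::nat) = \<one>" "m > 0"
    and v: "v \<in> carrier G" "v [^] (n::nat) = \<one>" "n > 0"
    and comm: "u \<otimes> v = v \<otimes> u"
  shows "subgroup {u [^] i \<otimes> v [^] j | (i::nat) (j::nat). True} G"
proof (rule subgroupI)
  let ?S = "{u [^] i \<otimes> v [^] j | (i::nat) (j::nat). True}"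
  have comm': "v [^] j \<otimes> u [^] i = u [^] i \<otimes> v [^] j" for i j :: nat
    using u v comm by (metis group_commutes_pow nat_pow_closed)
  show "?S \<subseteq> carrier G" using u v by auto
  show "?S \<noteq> {}" by auto
  show mult: "a \<otimes> b \<in> ?S" if mem: "a \<in> ?S" "b \<in> ?S" for a b
  proof -
    obtain i j k l where ab: "a = u [^] (i::nat) \<otimes> v [^] (j::nat)" "b = u [^] (k::nat) \<otimes> v [^] (l::nat)"
      using mem by blast
    have "a \<otimes> b = u [^] i \<otimes> (v [^] j \<otimes> u [^] k) \<otimes> v [^] l"
      using u v by (simp add: ab m_assoc)
    also have "\<dots> = u [^] (i + k) \<otimes> v [^] (j + l)"
      using u v by (simp add: comm' m_assoc flip: nat_pow_mult)
    finally show ?thesis by blast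
  qed
  show "inv a \<in> ?S" if mem: "a \<in> ?S" for a
  proof -
    obtain i j where a: "a = u [^] (i::nat) \<otimes> v [^] (j::nat)" using mem by blast
    have per: "w [^] (e * k + k) = \<one>" if "w \<in> carrier G" "w [^] (Suc e) = \<one>" for w and e k :: nat
      using that nat_pow_pow[of w "Suc e" k] by (simp add: add.commute del: nat_pow_Suc)
    have "(u [^] ((m - 1) * i) \<otimes> v [^] ((n - 1) * j)) \<otimes> a
        = u [^] ((m - 1) * i) \<otimes> (v [^] ((n - 1) * j) \<otimes> u [^] i) \<otimes> v [^] j"
      using u v by (simp add: a m_assoc)
    also have "\<dots> = u [^] ((m - 1) * i + i) \<otimes> v [^] ((n - 1) * j + j)"
      using u v by (simp add: comm' m_assoc flip: nat_pow_mult)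
    also have "\<dots> = \<one>"
      using per[of u "m - 1" i] per[of v "n - 1" j] u v by (simp del: nat_pow_Suc)
    finally have "inv a = u [^] ((m - 1) * i) \<otimes> v [^] ((n - 1) * j)"
      using u v by (intro inv_equality) (auto simp: a)
    then show ?thesis by blast
  qed
qed

lemma (in group) subgroup_involution:
  assumes "u \<in> carrier G" "u \<otimes> u = \<one>"
  shows "subgroup {\<one>, u} G"
  using assms by (intro subgroupI) (auto simp: inv_equality)

lemma (in group) not_cograph_of_commuting_involutions:
  assumes x: "x \<in> carrier G" "x \<otimes> x = \<one>" "x \<noteq> \<one>"
    and z: "z \<in> carrier G" "z \<otimes> z = \<one>" "z \<noteq> \<one>"
    and y: "y \<in> carrier G" "y [^] (n::nat) = \<one>" "odd n" "y \<noteq> \<one>"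
    and comm: "x \<otimes> y = y \<otimes> x" "z \<otimes> y = y \<otimes> z"
    and "x \<noteq> z"
  shows "\<not> cograph (intersection_subgroup_graph G)"
proof -
  define S where "S = (\<lambda>u. {u [^] i \<otimes> y [^] j | (i::nat) (j::nat). True})"
  have n: "n > 0" using y(3) by (rule odd_pos)
  have sub: "subgroup (S u) G" if "u \<in> carrier G" "u \<otimes> u = \<one>" "u \<otimes> y = y \<otimes> u" for u
    unfolding S_def using that y n
    by (intro subgroup_commuting_powers[where m = 2 and n = n]) (auto simp: numeral_2_eq_2)
  have mem: "u \<in> S u" "y \<in> S u" if "u \<in> carrier G" for u
  proof -
    have "u = u [^] (1::nat) \<otimes> y [^] (0::nat)" "y = u [^] (0::nat) \<otimes> y [^] (1::nat)"
      using that y by simp_all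
    then show "u \<in> S u" "y \<in> S u" unfolding S_def by blast+
  qed
  \<comment> \<open>Raising to the odd power \<open>n\<close> fixes every involution and maps \<open>S u\<close> into \<open>{\<one>, u}\<close>.\<close>
  have inv_S: "w = \<one> \<or> w = u"
    if u: "u \<in> carrier G" "u \<otimes> u = \<one>" "u \<otimes> y = y \<otimes> u"
      and w: "w \<in> carrier G" "w \<otimes> w = \<one>" "w \<in> S u" for u w
  proof -
    obtain i j where ij: "w = u [^] (i::nat) \<otimes> y [^] (j::nat)" using w(3) unfolding S_def by blast
    have "w = w [^] n" using involution_nat_pow[OF w(1,2)] y(3) by simp
    also have "\<dots> = (u [^] i) [^] n \<otimes> (y [^] j) [^] n"
      unfolding ij using u y
      by (intro pow_mult_distrib) (metis group_commutes_pow nat_pow_closed, auto)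
    also have "(y [^] j) [^] n = \<one>"
      using y by (metis nat_pow_pow mult.commute nat_pow_one)
    also have "(u [^] i) [^] n \<otimes> \<one> = u [^] (i * n)"
      using u by (simp add: nat_pow_pow)
    finally show ?thesis using involution_nat_pow[OF u(1,2)] by metis
  qed
  have one: "\<one> \<in> S x" "\<one> \<in> S z"
    using sub x z comm subgroup.one_closed by blast+
  show ?thesis
  proof (rule not_cograph_intersection_subgroup_graphI[where A = "S x" and B = "{\<one>, z}" and C = "{\<one>, x}" and D = "S z"])
    show "nontrivial_subgroup G (S x)" "nontrivial_subgroup G (S z)"
      using sub mem x z comm by (auto simp: nontrivial_subgroup_def)
    show "nontrivial_subgroup G {\<one>, z}" "nontrivial_subgroup G {\<one>, x}"
      using subgroup_involution x z by (auto simp: nontrivial_subgroup_def)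
    \<comment> \<open>By \<open>inv_S\<close> and \<open>x \<noteq> z\<close>, the involution
      \<open>z\<close> is not in \<open>S x\<close> and \<open>x\<close> is not in
      \<open>S z\<close>.\<close>
    show "S x \<inter> {\<one>, z} = {\<one>}" "{\<one>, z} \<inter> {\<one>, x} = {\<one>}" "{\<one>, x} \<inter> S z = {\<one>}"
      using inv_S[of x z] inv_S[of z x] x z comm one \<open>x \<noteq> z\<close> by auto
    \<comment> \<open>Nontrivial common elements are \<open>x\<close>, \<open>y\<close> and
      \<open>z\<close>, in this order.\<close>
    show "S x \<inter> {\<one>, x} \<noteq> {\<one>}" "S x \<inter> S z \<noteq> {\<one>}" "{\<one>, z} \<inter> S z \<noteq> {\<one>}"
      using mem x y z by blast+
  qed
qed

section \<open>Finite fields: elements of norm one and characteristic two\<close>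

text \<open>Multiplication by \<open>t\<close> permutes the nonzero elements, so it leaves their
  product, which is nonzero, unchanged; cancel that product.\<close>

lemma field_power_CARD_minus_one:
  fixes t :: "'a::field"
  assumes "finite (UNIV :: 'a set)" "t \<noteq> 0"
  shows "t ^ (CARD('a) - 1) = 1"
proof -
  let ?P = "\<Prod>(UNIV - {0 :: 'a})"
  have "bij_betw ((*) t) (UNIV - {0}) (UNIV - {0})"
  proof (rule bij_betwI[where g = "\<lambda>s. s / t"])
    show "(*) t \<in> UNIV - {0} \<rightarrow> UNIV - {0}" "(\<lambda>s. s / t) \<in> UNIV - {0} \<rightarrow> UNIV - {0}"
      using assms(2) by simp_all
  qed (use assms(2) in simp_all)
  then have "?P = (\<Prod>s\<in>UNIV - {0}. t * s)"
    using prod.reindex_bij_betw[where g = "\<lambda>s. s"] by metis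
  also have "\<dots> = t ^ (CARD('a) - 1) * ?P"
    using assms(1) by (simp add: prod.distrib card_Diff_singleton)
  finally show ?thesis using assms(1) by simp
qed

text \<open>Every \<open>t ^ (q - 1)\<close> with \<open>t \<noteq> 0\<close> has norm one. If all
  their cubes were 1, then \<open>X ^ (3 * (q - 1)) - 1\<close> would have
  \<open>(q + 1) * (q - 1)\<close> roots, more than its degree.\<close>

lemma ex_norm_one_cube_neq_one:
  assumes "q \<ge> 3" and card: "CARD('a::field) = q ^ 2"
  obtains a :: "'a::field" where "a ^ (q + 1) = 1" "a ^ 3 \<noteq> 1"
proof -
  have fin: "finite (UNIV :: 'a set)"
    using assms by (intro card_ge_0_finite) simp
  define m where "m = 3 * (q - 1)"
  have "m > 0" using assms by (simp add: m_def)
  have "\<exists>t::'a. t \<noteq> 0 \<and> t ^ m \<noteq> 1"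
  proof (rule ccontr)
    assume *: "\<not> ?thesis"
    define p :: "'a poly" where "p = Polynomial.monom 1 m + [:-1:]"
    have deg: "degree p = m"
      unfolding p_def using \<open>m > 0\<close> by (subst degree_add_eq_left) (auto simp: degree_monom_eq)
    have "p \<noteq> 0" using deg \<open>m > 0\<close> by auto
    have "UNIV - {0} \<subseteq> {t. poly p t = 0}"
      using * by (auto simp: p_def poly_monom)
    then have "card (UNIV - {0 :: 'a}) \<le> card {t. poly p t = 0}"
      by (rule card_mono[OF poly_roots_finite[OF \<open>p \<noteq> 0\<close>]])
    then have "q ^ 2 - 1 \<le> card {t. poly p t = 0}"
      using fin card by (simp add: card_Diff_singleton)
    also have "\<dots> \<le> m" using card_poly_roots_bound[OF \<open>p \<noteq> 0\<close>] deg by simp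
    finally have "(q + 1) * (q - 1) \<le> 3 * (q - 1)"
      by (simp add: m_def power2_eq_square algebra_simps)
    then have "q + 1 \<le> 3" unfolding mult_le_cancel2 using assms(1) by linarith
    then show False using assms(1) by simp
  qed
  then obtain t :: 'a where t: "t \<noteq> 0" "t ^ m \<noteq> 1" by blast
  show thesis
  proof
    have "(q - 1) * (q + 1) = CARD('a) - 1"
      by (simp add: card power2_eq_square algebra_simps)
    then show "(t ^ (q - 1)) ^ (q + 1) = 1"
      using field_power_CARD_minus_one[OF fin t(1)] by (metis power_mult)
    show "(t ^ (q - 1)) ^ 3 \<noteq> 1"
      using t(2) by (simp add: m_def mult.commute flip: power_mult)
  qed
qed

text \<open>The characteristic divides the cardinality, so a power of 2 vanishes in the
  field.\<close>

lemma two_eq_zero_of_CARD: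
  assumes "CARD('a::field) = 2 ^ n"
  shows "(2 :: 'a::field) = 0"
proof -
  have "of_nat (2 ^ n) = (0 :: 'a)"
    using CHAR_dvd_CARD[where 'a = 'a] assms by (simp only: of_nat_eq_0_iff_char_dvd)
  then show ?thesis by simp
qed

section \<open>Scalar matrices and classes modulo scalars\<close>

lemma matrix_mult_mat:
  "A ** mat c = (\<chi> i j. A $ i $ j * (c :: 'a::semiring_1))"
proof -
  have "(\<Sum>k\<in>UNIV. A $ i $ k * (if k = j then c else 0)) = A $ i $ j * c" for i j
  proof -
    have "(\<Sum>k\<in>UNIV. A $ i $ k * (if k = j then c else 0)) = (\<Sum>k\<in>UNIV. if k = j then A $ i $ k * c else 0)"
      by (intro sum.cong) auto
    then show ?thesis by simp
  qed
  then show ?thesis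
    by (simp add: vec_eq_iff matrix_matrix_mult_def mat_def)
qed

lemma mat_mult_matrix:
  "mat c ** A = (\<chi> i j. (c :: 'a::semiring_1) * A $ i $ j)"
proof -
  have "(\<Sum>k\<in>UNIV. (if i = k then c else 0) * A $ k $ j) = c * A $ i $ j" for i j
  proof -
    have "(\<Sum>k\<in>UNIV. (if i = k then c else 0) * A $ k $ j) = (\<Sum>k\<in>UNIV. if i = k then c * A $ k $ j else 0)"
      by (intro sum.cong) auto
    then show ?thesis by simp
  qed
  then show ?thesis
    by (simp add: vec_eq_iff matrix_matrix_mult_def mat_def)
qed

lemma mat_mult_mat: "mat c ** mat d = (mat (c * d) :: 'a::semiring_1 ^ 'n ^ 'n)"
  unfolding mat_mult_matrix by (simp add: vec_eq_iff mat_def)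

lemma mat_mult_commute: "mat c ** A = A ** mat (c :: 'a::comm_semiring_1)"
  by (simp add: matrix_mult_mat mat_mult_matrix mult.commute)

lemma conj_transpose_mat:
  assumes "q > 0"
  shows "conj_transpose q (mat c :: 'a::field ^ 'n ^ 'n) = mat (c ^ q)"
  using assms by (simp add: conj_transpose_def mat_def vec_eq_iff)

lemma SU_scalars_mult:
  assumes "q > 0" "A \<in> SU_scalars q" "B \<in> SU_scalars q"
  shows "A ** B \<in> SU_scalars q"
proof -
  obtain c d where cd: "A = mat c" "B = mat d"
    using assms by (auto simp: SU_scalars_def)
  then have *: "mat (c * c ^ q) = (mat 1 :: 'a ^ 'b ^ 'b)" "mat (d * d ^ q) = (mat 1 :: 'a ^ 'b ^ 'b)"
      "det A = 1" "det B = 1"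
    using assms by (simp_all add: SU_scalars_def SU_def conj_transpose_mat mat_mult_mat)
  have "(A ** B) ** conj_transpose q (A ** B) = mat (c * c ^ q) ** mat (d * d ^ q)"
    using assms(1) by (simp add: cd mat_mult_mat conj_transpose_mat power_mult_distrib mult.assoc mult.left_commute)
  also have "\<dots> = mat 1"
    by (simp add: *(1,2))
  finally show ?thesis
    using *(3,4) by (auto simp: SU_scalars_def SU_def det_mul cd) (auto simp: mat_mult_mat)
qed

lemma mat_one_in_SU_scalars: "q > 0 \<Longrightarrow> mat 1 \<in> SU_scalars q"
  by (auto simp: SU_scalars_def SU_def conj_transpose_mat)

text \<open>
  Scalar matrices are central, so the classes of arbitrary matrices multiply as expected without any
  appeal to the group structure of \<open>SU\<close>.
\<close>

definition PSU_class :: "nat \<Rightarrow> 'a::field ^ 'n ^ 'n \<Rightarrow> ('a ^ 'n ^ 'n) set" where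
  "PSU_class q A = SU_scalars q #>\<^bsub>SU q\<^esub> A"

lemma mem_PSU_class: "B \<in> PSU_class q A \<longleftrightarrow> (\<exists>N\<in>SU_scalars q. B = N ** A)"
  by (auto simp: PSU_class_def r_coset_def SU_def)

lemma PSU_class_closed: "A \<in> carrier (SU q) \<Longrightarrow> PSU_class q A \<in> carrier (PSU q)"
  by (auto simp: PSU_class_def PSU_def FactGroup_def RCOSETS_def)

lemma PSU_class_mult:
  assumes "q > 0"
  shows "PSU_class q A \<otimes>\<^bsub>PSU q\<^esub> PSU_class q B = PSU_class q (A ** B)"
proof -
  have comm: "(N ** A) ** (M ** B) = (N ** M) ** (A ** B)" if "M \<in> SU_scalars q" for M N
  proof -
    from that obtain c where "M = mat c" by (auto simp: SU_scalars_def)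
    then have "A ** M = M ** A" by (simp add: mat_mult_commute)
    then show ?thesis by (metis matrix_mul_assoc)
  qed
  have "C \<in> PSU_class q A \<otimes>\<^bsub>PSU q\<^esub> PSU_class q B \<longleftrightarrow> C \<in> PSU_class q (A ** B)" for C
  proof -
    have "C \<in> PSU_class q A \<otimes>\<^bsub>PSU q\<^esub> PSU_class q B \<longleftrightarrow> (\<exists>N\<in>SU_scalars q. \<exists>M\<in>SU_scalars q. C = (N ** A) ** (M ** B))"
    proof -
      have "C \<in> PSU_class q A \<otimes>\<^bsub>PSU q\<^esub> PSU_class q B \<longleftrightarrow> (\<exists>X\<in>PSU_class q A. \<exists>Y\<in>PSU_class q B. C = X ** Y)"
        by (auto simp: PSU_def FactGroup_def set_mult_def SU_def)
      then show ?thesis by (metis mem_PSU_class)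
    qed
    also have "\<dots> \<longleftrightarrow> (\<exists>N\<in>SU_scalars q. \<exists>M\<in>SU_scalars q. C = (N ** M) ** (A ** B))"
      by (intro bex_cong refl) (simp add: comm)
    \<comment> \<open>From left to right, \<open>N ** M\<close> is again in
      \<open>SU_scalars q\<close>; conversely, take \<open>M = mat 1\<close>.\<close>
    also have "\<dots> \<longleftrightarrow> C \<in> PSU_class q (A ** B)"
      unfolding mem_PSU_class
      using SU_scalars_mult[OF assms] mat_one_in_SU_scalars[OF assms] by (metis matrix_mul_rid)
    finally show ?thesis .
  qed
  then show ?thesis by blast
qed

text \<open>Separates classes by comparing matrix entries: \<open>A\<close> lies in its own class
  through the scalar \<open>mat 1\<close>, hence in that of \<open>B\<close>.\<close>

lemma PSU_class_eqD:
  assumes "q > 0" "PSU_class q A = PSU_class q B"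
  obtains c where "A = mat c ** B"
proof -
  have "A \<in> PSU_class q A"
    unfolding mem_PSU_class using mat_one_in_SU_scalars[OF assms(1)] matrix_mul_lid by metis
  then show thesis
    using assms that by (auto simp: mem_PSU_class SU_scalars_def)
qed

section \<open>The diagonal and swap matrices\<close>

text \<open>The repeated entry makes this commute with every \<open>swap_mat b\<close>; the last
  entry gives determinant 1 for nonzero \<open>a\<close>.\<close>

definition diag_mat :: "'a::field \<Rightarrow> 'a ^ 3 ^ 3" where
  "diag_mat a = vector [vector [a, 0, 0], vector [0, a, 0], vector [0, 0, inverse (a ^ 2)]]"

definition swap_mat :: "'a::field \<Rightarrow> 'a ^ 3 ^ 3" where
  "swap_mat b = vector [vector [0, b, 0], vector [inverse b, 0, 0], vector [0, 0, 1]]"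

lemmas mat3_simps =
  vec_eq_iff forall_3 matrix_matrix_mult_def sum_3 det_3 conj_transpose_def mat_def
  diag_mat_def swap_mat_def

lemma diag_mat_mult: "diag_mat a ** diag_mat b = diag_mat (a * b)"
  by (simp add: mat3_simps power_mult_distrib)

lemma swap_mat_square: "b \<noteq> 0 \<Longrightarrow> swap_mat b ** swap_mat b = mat 1"
  by (simp add: mat3_simps)

lemma swap_mat_diag_mat_commute: "swap_mat b ** diag_mat a = diag_mat a ** swap_mat b"
  by (simp add: mat3_simps)

lemma diag_mat_in_SU:
  assumes "a ^ (q + 1) = 1" "q > 0"
  shows "diag_mat a \<in> carrier (SU q)"
proof -
  have a: "a * a ^ q = 1" "a \<noteq> 0"
    using assms by auto
  \<comment> \<open>The norm \<open>t * t ^ q\<close> is multiplicative, so it is 1 at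
    \<open>a ^ 2\<close> and then at the inverse of \<open>a ^ 2\<close>.\<close>
  have "a ^ 2 * (a ^ 2) ^ q = 1"
  proof -
    have "a ^ 2 * (a ^ 2) ^ q = (a * a ^ q) ^ 2"
      by (simp add: power_mult_distrib mult.commute flip: power_mult)
    then show ?thesis using a(1) by simp
  qed
  then have "inverse (a ^ 2) * inverse (a ^ 2) ^ q = 1"
    by (metis inverse_1 inverse_mult_distrib power_inverse)
  then show ?thesis using a assms(2)
    by (auto simp: SU_def mat3_simps power2_eq_square field_simps)
qed

lemma swap_mat_in_SU:
  assumes "(2 :: 'a::field) = 0" and b: "b ^ (q + 1) = (1 :: 'a)" and "q > 0"
  shows "swap_mat b \<in> carrier (SU q)"
proof -
  have b: "b * b ^ q = 1" "b \<noteq> 0" using b by auto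
  have "inverse b * inverse b ^ q = 1"
    using b by (metis inverse_1 inverse_mult_distrib power_inverse)
  moreover have "- 1 = (1 :: 'a)"
    using assms(1) by (simp add: minus_equation_iff eq_neg_iff_add_eq_0)
  ultimately show ?thesis using b \<open>q > 0\<close>
    by (auto simp: SU_def mat3_simps)
qed

section \<open>Transfer to a group isomorphic to \<open>PSU(3, q)\<close>\<close>

theorem theorem8p7:
  fixes G :: "('g, 'b) monoid_scheme" and q k :: nat
  assumes "q = 2 ^ k" and "q \<ge> 4"
    and "CARD('a::field) = q ^ 2"
    and "group G"
    and "G \<cong> (PSU q :: ('a ^ 3 ^ 3) set monoid)"
  shows "\<not> cograph (intersection_subgroup_graph G)"
proof -
  interpret group G by fact
  have q: "q > 0" "q \<ge> 3" using assms(2) by auto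
  have two: "(2 :: 'a) = 0"
    using two_eq_zero_of_CARD[where 'a = 'a and n = "k * 2"] assms(1,3) by (simp add: power_mult)
  have "even q" using assms(1,2) by (cases k) auto
  obtain a :: 'a where a: "a ^ (q + 1) = 1" "a ^ 3 \<noteq> 1"
    using ex_norm_one_cube_neq_one[OF q(2) assms(3)] by blast
  have a': "a \<noteq> 0" "a \<noteq> 1" using a by auto
  obtain h where h: "h \<in> iso G (PSU q :: ('a ^ 3 ^ 3) set monoid)"
    using assms(5) by (auto simp: is_iso_def)
  then have h_hom: "h \<in> hom G (PSU q)"
    and h_bij: "bij_betw h (carrier G) (carrier (PSU q :: ('a ^ 3 ^ 3) set monoid))"
    by (simp_all add: iso_def)
  note h_inj = bij_betw_imp_inj_on[OF h_bij]
  \<comment> \<open>Classes are pulled back along \<open>h\<close>, so that the group laws of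
    \<open>G\<close> apply; \<open>f A\<close> is meaningful for \<open>A\<close> in
    \<open>SU q\<close>.\<close>
  define f where "f = (\<lambda>A. the_inv_into (carrier G) h (PSU_class q A))"
  have f_carrier: "f A \<in> carrier G" and hf: "h (f A) = PSU_class q A" if "A \<in> carrier (SU q)" for A
  proof -
    show "f A \<in> carrier G"
      unfolding f_def using bij_betw_apply[OF bij_betw_the_inv_into[OF h_bij] PSU_class_closed[OF that]] .
    show "h (f A) = PSU_class q A"
      unfolding f_def using f_the_inv_into_f_bij_betw[OF h_bij] PSU_class_closed[OF that] by blast
  qed
  have f_eq: "\<exists>c. A = mat c ** B" if "A \<in> carrier (SU q)" "B \<in> carrier (SU q)" "f A = f B" for A B
    using hf[OF that(1)] hf[OF that(2)] that(3) PSU_class_eqD[OF q(1)] by metis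
  have f_mult: "f A \<otimes>\<^bsub>G\<^esub> f B = f (A ** B)"
    if "A \<in> carrier (SU q)" "B \<in> carrier (SU q)" "A ** B \<in> carrier (SU q)" for A B
  proof -
    have "h (f A \<otimes>\<^bsub>G\<^esub> f B) = h (f (A ** B))"
      using that by (simp add: hom_mult[OF h_hom] f_carrier hf PSU_class_mult[OF q(1)])
    then show ?thesis
      using that by (simp add: inj_on_eq_iff[OF h_inj] f_carrier)
  qed
  have one: "(mat 1 :: 'a ^ 3 ^ 3) \<in> carrier (SU q)"
    using mat_one_in_SU_scalars[OF q(1)] by (auto simp: SU_scalars_def)
  have f_one: "f (mat 1) = \<one>\<^bsub>G\<^esub>"
    \<comment> \<open>\<open>f (mat 1)\<close> is idempotent, and the identity is the only
      idempotent of a group.\<close>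
    using f_mult[OF one one] one f_carrier[OF one] by (simp add: l_cancel_one)
  note diag = diag_mat_in_SU[OF _ q(1)]
  note swap = swap_mat_in_SU[OF two _ q(1)]
  have S_comm: "f (swap_mat b) \<otimes>\<^bsub>G\<^esub> f (diag_mat a) = f (diag_mat a) \<otimes>\<^bsub>G\<^esub> f (swap_mat b)"
    if b: "b ^ (q + 1) = 1" for b
  proof -
    have "h (f (swap_mat b) \<otimes>\<^bsub>G\<^esub> f (diag_mat a)) = h (f (diag_mat a) \<otimes>\<^bsub>G\<^esub> f (swap_mat b))"
      by (simp add: hom_mult[OF h_hom] f_carrier hf PSU_class_mult[OF q(1)] diag[OF a(1)] swap[OF b]
          swap_mat_diag_mat_commute)
    then show ?thesis
      by (simp add: inj_on_eq_iff[OF h_inj] f_carrier diag[OF a(1)] swap[OF b])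
  qed
  have S_square: "f (swap_mat b) \<otimes>\<^bsub>G\<^esub> f (swap_mat b) = \<one>\<^bsub>G\<^esub>" if b: "b ^ (q + 1) = 1" for b
  proof -
    have "b \<noteq> 0" using b by auto
    then show ?thesis
      using f_mult[OF swap[OF b] swap[OF b]] by (simp add: swap_mat_square one f_one)
  qed
  have S_neq: "f (swap_mat b) \<noteq> \<one>\<^bsub>G\<^esub>" if b: "b ^ (q + 1) = 1" for b
  proof
    assume "f (swap_mat b) = \<one>\<^bsub>G\<^esub>"
    then obtain c where "swap_mat b = mat c ** mat 1"
      using f_eq[OF swap[OF b] one] f_one by auto
    \<comment> \<open>A scalar matrix has zero off-diagonal entries.\<close>
    then have "b = 0" by (simp add: mat3_simps)
    then show False using b by simp
  qed
  have f_pow: "f (diag_mat a) [^]\<^bsub>G\<^esub> (i::nat) = f (diag_mat (a ^ i))" for i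
  proof (induction i)
    case 0
    have "diag_mat (1::'a) = mat 1" by (simp add: mat3_simps)
    then show ?case by (simp add: f_one)
  next
    case (Suc i)
    \<comment> \<open>Powers of \<open>a\<close> keep norm one, so their diagonal matrices stay in
      \<open>SU q\<close> and \<open>f_mult\<close> applies.\<close>
    have "(a ^ i) ^ (q + 1) = 1" for i
      using a(1) by (metis mult.commute power_mult power_one)
    from this[of i] this[of "Suc i"] Suc show ?case
      using f_mult[of "diag_mat (a ^ i)" "diag_mat a"] a(1)
      by (simp add: diag diag_mat_mult mult.commute)
  qed
  have "diag_mat (1::'a) = mat 1" by (simp add: mat3_simps)
  then have T_order: "f (diag_mat a) [^]\<^bsub>G\<^esub> (q + 1) = \<one>\<^bsub>G\<^esub>"
    using f_pow[of "q + 1"] a(1) f_one by simp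
  have T_neq: "f (diag_mat a) \<noteq> \<one>\<^bsub>G\<^esub>"
  proof
    assume "f (diag_mat a) = \<one>\<^bsub>G\<^esub>"
    then obtain c where "diag_mat a = mat c ** mat 1"
      using f_eq[OF diag[OF a(1)] one] f_one by auto
    \<comment> \<open>The first and last diagonal entries of a scalar matrix agree, which forces
      \<open>a ^ 3 = 1\<close>.\<close>
    then have "inverse (a ^ 2) = a" by (auto simp: mat3_simps)
    then have "a * a ^ 2 = 1" using a'(1) by (metis power_eq_0_iff right_inverse inverse_inverse_eq mult.commute)
    then show False using a(2) by (simp add: power3_eq_cube power2_eq_square mult.assoc)
  qed
  have "f (swap_mat 1) \<noteq> f (swap_mat a)"
  proof
    assume "f (swap_mat 1) = f (swap_mat a)"
    then obtain c where "swap_mat 1 = mat c ** swap_mat a"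
      using f_eq[OF swap[of 1] swap[OF a(1)]] by auto
    \<comment> \<open>The last diagonal entry gives \<open>c = 1\<close>, and the entry in row 1,
      column 2 then gives \<open>a = 1\<close>.\<close>
    then have "1 = c \<and> 1 = c * a" by (auto simp: mat3_simps)
    then show False using a'(2) by auto
  qed
  then show ?thesis
    using \<open>even q\<close> a(1) T_order T_neq S_comm S_square S_neq
    by (intro not_cograph_of_commuting_involutions[where x = "f (swap_mat 1)" and y = "f (diag_mat a)"
        and z = "f (swap_mat a)" and n = "q + 1"])
      (simp_all add: f_carrier diag swap)
qed

end
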